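(* For every $n\ge 1$ and $\beta\ge 0$, the stationary expected social welfare of the logit dynamics with inverse noise $\beta$ for the $n$-player XOR game is $$\mathbf{E}_\pi[W]=-\frac{n}{1+e^{\beta}}.$$
   Context: XOR game: $n$ players, each with strategy set $\{0,1\}$; for every player $i$, $u_i(\mathbf{x})=-1$ if $\mathbf{x}$ has an odd number of $1$'s and $u_i(\mathbf{x})=0$ if $\mathbf{x}$ has an even number of $1$'s. Logit dynamics: for a strategic game with $n$ players, finite strategy sets $S_i$ and utilities $u_i:\prod_j S_j\to\mathbb{R}$, and for $\beta\ge 0$, let $\sigma_i(y\mid\mathbf{x})=e^{\beta u_i(\mathbf{x}_{-i},y)}/\sum_{z\in S_i}e^{\beta u_i(\mathbf{x}_{-i},z)}$, where $(\mathbf{x}_{-i},y)$ is $\mathbf{x}$ with its $i$-th entry replaced by $y$. The logit dynamics with inverse noise $\beta$ is the Markov chain on $\Omega=\prod_j S_j$ which, from profile $\mathbf{x}$, selects a player $i$ uniformly at random and replaces $x_i$ by $y\in S_i$ with probability $\sigma_i(y\mid\mathbf{x})$. It is irreducible and aperiodic; $\pi$ denotes its unique stationary distribution. The social welfare is $W(\mathbf{x})=\sum_i u_i(\mathbf{x})$, and $\mathbf{E}_\pi[W]=\sum_{\mathbf{x}}W(\mathbf{x})\pi(\mathbf{x})$. *)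

theory Defs
  imports "HOL-Probability.Probability"
begin

record ('i, 's) game =
  players :: "'i set"
  strategies :: "'i \<Rightarrow> 's set"
  utility :: "'i \<Rightarrow> ('i \<Rightarrow> 's) \<Rightarrow> real"

definition profiles :: "('i, 's) game \<Rightarrow> ('i \<Rightarrow> 's) set" where
  "profiles G = PiE (players G) (strategies G)"

definition social_welfare :: "('i, 's) game \<Rightarrow> ('i \<Rightarrow> 's) \<Rightarrow> real" where
  "social_welfare G x = (\<Sum>i\<in>players G. utility G i x)"

definition logit_prob :: "real \<Rightarrow> ('i, 's) game \<Rightarrow> 'i \<Rightarrow> ('i \<Rightarrow> 's) \<Rightarrow> 's \<Rightarrow> real" where
  "logit_prob \<beta> G i x y =
     exp (\<beta> * utility G i (x(i := y))) /
     (\<Sum>z\<in>strategies G i. exp (\<beta> * utility G i (x(i := z))))"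

definition logit_choice :: "real \<Rightarrow> ('i, 's) game \<Rightarrow> 'i \<Rightarrow> ('i \<Rightarrow> 's) \<Rightarrow> 's pmf" where
  "logit_choice \<beta> G i x =
     embed_pmf (\<lambda>y. if y \<in> strategies G i then logit_prob \<beta> G i x y else 0)"

(* embed_pmf is only meaningful for a genuine probability mass function; this is the case here. *)
lemma pmf_logit_choice:
  assumes "finite (strategies G i)" "strategies G i \<noteq> {}"
  shows "pmf (logit_choice \<beta> G i x) y =
           (if y \<in> strategies G i then logit_prob \<beta> G i x y else 0)"
  unfolding logit_choice_def
proof (rule pmf_embed_pmf)
  let ?S = "strategies G i"
  let ?f = "\<lambda>y. if y \<in> ?S then logit_prob \<beta> G i x y else 0"
  have nonneg: "0 \<le> logit_prob \<beta> G i x y" for y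
    unfolding logit_prob_def by (intro divide_nonneg_nonneg sum_nonneg) auto
  then show "0 \<le> ?f y" for y by simp
  have pos: "(\<Sum>z\<in>?S. exp (\<beta> * utility G i (x(i := z)))) > 0"
    using assms by (intro sum_pos) auto
  have "(\<integral>\<^sup>+y. ennreal (?f y) \<partial>count_space UNIV) = (\<Sum>y\<in>?S. ennreal (?f y))"
    using assms(1) by (intro nn_integral_count_space') (auto split: if_splits)
  also have "\<dots> = ennreal (\<Sum>y\<in>?S. logit_prob \<beta> G i x y)"
    using nonneg by (simp add: sum_ennreal)
  also have "(\<Sum>y\<in>?S. logit_prob \<beta> G i x y) = 1"
    unfolding logit_prob_def using pos by (simp flip: sum_divide_distrib)
  finally show "(\<integral>\<^sup>+y. ennreal (?f y) \<partial>count_space UNIV) = 1" by simp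
qed

definition logit_step :: "real \<Rightarrow> ('i, 's) game \<Rightarrow> ('i \<Rightarrow> 's) \<Rightarrow> ('i \<Rightarrow> 's) pmf" where
  "logit_step \<beta> G x =
     bind_pmf (pmf_of_set (players G)) (\<lambda>i. map_pmf (\<lambda>y. x(i := y)) (logit_choice \<beta> G i x))"

definition stationary_on :: "'a set \<Rightarrow> ('a \<Rightarrow> 'a pmf) \<Rightarrow> 'a pmf \<Rightarrow> bool" where
  "stationary_on \<Omega> K \<pi> \<longleftrightarrow> set_pmf \<pi> \<subseteq> \<Omega> \<and> bind_pmf \<pi> K = \<pi>"

(* The definite description denotes the stationary distribution because the chain is
   irreducible on the finite set of profiles (for finitely many players, at least one,
   with finite nonempty strategy sets). *)
definition logit_stationary :: "real \<Rightarrow> ('i, 's) game \<Rightarrow> ('i \<Rightarrow> 's) pmf" where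
  "logit_stationary \<beta> G = (THE \<pi>. stationary_on (profiles G) (logit_step \<beta> G) \<pi>)"

definition xor_game :: "nat \<Rightarrow> (nat, nat) game" where
  "xor_game n =
     \<lparr> players = {..<n},
       strategies = (\<lambda>i. {0, 1}),
       utility = (\<lambda>i x. if odd (card {j \<in> {..<n}. x j = 1}) then -1 else 0) \<rparr>"

lemma expectation_eq_sum_profiles:
  assumes "finite (profiles G)" "set_pmf \<pi> \<subseteq> profiles G"
  shows "measure_pmf.expectation \<pi> (social_welfare G) =
           (\<Sum>x\<in>profiles G. social_welfare G x * pmf \<pi> x)"
  using assms by (subst integral_measure_pmf_real[where A = "profiles G"]) auto

end

theory Submission
  imports Defs
begin

text \<open>
  Changing one entry of a profile to 0 or to 1 yields one even and one odd profile. Hence,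
  whatever the current profile and the selected player, the profile after one step of the logit
  dynamics is odd with probability \<open>1 / (1 + exp \<beta>)\<close>, so this is also the stationary probability
  of odd profiles. The stationary distribution exists because the game has a common utility
  function, for which the Gibbs distribution is reversible. It is unique because the chain is
  irreducible.
\<close>

section \<open>Stationary distributions of finite Markov chains: uniqueness and detailed
  balance\<close>

lemma stationary_on_pmf_eq:
  assumes "finite \<Omega>" "stationary_on \<Omega> K \<mu>"
  shows "pmf \<mu> y = (\<Sum>x\<in>\<Omega>. pmf \<mu> x * pmf (K x) y)"
proof -
  have "pmf \<mu> y = pmf (bind_pmf \<mu> K) y"
    using assms(2) by (simp add: stationary_on_def)
  also have "\<dots> = (\<Sum>x\<in>\<Omega>. pmf (K x) y * pmf \<mu> x)"
    unfolding pmf_bind using assms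
    by (intro integral_measure_pmf_real) (auto simp: stationary_on_def)
  finally show ?thesis by (simp add: mult.commute)
qed

text \<open>A sum of nonnegative terms vanishes only if every term does, so a zero of
  \<open>g\<close> at a state spreads to each predecessor of that state and thus back along the
  whole path. Taking a real function \<open>g\<close> instead of a distribution lets the lemma also
  apply to differences of distributions.\<close>

lemma invariant_zero_backward:
  fixes g :: "'a \<Rightarrow> real"
  assumes "finite \<Omega>"
    and nonneg: "\<And>x. x \<in> \<Omega> \<Longrightarrow> 0 \<le> g x"
    and inv: "\<And>y. y \<in> \<Omega> \<Longrightarrow> g y = (\<Sum>x\<in>\<Omega>. g x * pmf (K x) y)"
    and path: "(x, z) \<in> {(x, y). x \<in> \<Omega> \<and> y \<in> \<Omega> \<and> y \<in> set_pmf (K x)}\<^sup>*"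
    and "g z = 0"
  shows "g x = 0"
  using path
proof (induction rule: converse_rtrancl_induct)
  case base
  show ?case by fact
next
  case (step x y)
  then have xy: "x \<in> \<Omega>" "y \<in> \<Omega>" "pmf (K x) y \<noteq> 0"
    by (auto simp: set_pmf_iff)
  have "(\<Sum>x\<in>\<Omega>. g x * pmf (K x) y) = 0"
    using inv[OF xy(2)] step.IH by simp
  then have "g x * pmf (K x) y = 0"
    using xy(1) nonneg assms(1) by (subst (asm) sum_nonneg_eq_0_iff) auto
  then show ?case using xy(3) by simp
qed

text \<open>Subtract from \<mu> the largest multiple of \<nu> that leaves a nonnegative function on
  \<Omega>. The difference is invariant and has a zero, so irreducibility makes it vanish on
  \<Omega>; equal total masses then force the factor to be 1.\<close>

lemma stationary_on_unique:
  assumes fin: "finite \<Omega>"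
    and irred: "\<And>x z. x \<in> \<Omega> \<Longrightarrow> z \<in> \<Omega> \<Longrightarrow>
      (x, z) \<in> {(x, y). x \<in> \<Omega> \<and> y \<in> \<Omega> \<and> y \<in> set_pmf (K x)}\<^sup>*"
    and \<mu>: "stationary_on \<Omega> K \<mu>" and \<nu>: "stationary_on \<Omega> K \<nu>"
  shows "\<mu> = \<nu>"
proof -
  have sub: "set_pmf \<mu> \<subseteq> \<Omega>" "set_pmf \<nu> \<subseteq> \<Omega>"
    using \<mu> \<nu> by (auto simp: stationary_on_def)
  have ne: "\<Omega> \<noteq> {}"
    using sub(1) set_pmf_not_empty[of \<mu>] by auto
  have sums: "(\<Sum>x\<in>\<Omega>. pmf \<mu> x) = 1" "(\<Sum>x\<in>\<Omega>. pmf \<nu> x) = 1"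
    using sum_pmf_eq_1[OF fin] sub by auto
  \<comment> \<open>A zero of \<nu> would spread over all of \<Omega>, leaving total mass 0.
    Positivity makes the ratio \<open>q\<close> below meaningful.\<close>
  have pos: "pmf \<nu> x > 0" if "x \<in> \<Omega>" for x
  proof (rule ccontr)
    assume "\<not> pmf \<nu> x > 0"
    then have "pmf \<nu> x = 0" using pmf_nonneg[of \<nu> x] by linarith
    then have "pmf \<nu> y = 0" if "y \<in> \<Omega>" for y
      by (rule invariant_zero_backward[OF fin pmf_nonneg stationary_on_pmf_eq[OF fin \<nu>]
            irred[OF that \<open>x \<in> \<Omega>\<close>]])
    then show False using sums(2) by simp
  qed
  define q where "q x = pmf \<mu> x / pmf \<nu> x" for x
  have "\<exists>x\<in>\<Omega>. \<forall>y\<in>\<Omega>. q x \<le> q y"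
    using arg_min_if_finite(1)[OF fin ne, of q] arg_min_least[OF fin ne, of _ q] by blast
  then obtain z where z: "z \<in> \<Omega>" "\<And>y. y \<in> \<Omega> \<Longrightarrow> q z \<le> q y" by auto
  \<comment> \<open>Since \<open>z\<close> minimises the ratio \<open>q\<close>, the function
    \<open>d\<close> is nonnegative on \<Omega> and vanishes at \<open>z\<close>.\<close>
  define d where "d x = pmf \<mu> x - q z * pmf \<nu> x" for x
  have "d x = 0" if x: "x \<in> \<Omega>" for x
  proof (rule invariant_zero_backward[OF fin _ _ irred[OF x z(1)]])
    show "0 \<le> d y" if "y \<in> \<Omega>" for y
      using z(2)[OF that] pos[OF that] by (simp add: d_def q_def le_divide_eq)
    show "d y = (\<Sum>x\<in>\<Omega>. d x * pmf (K x) y)" for y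
      unfolding d_def stationary_on_pmf_eq[OF fin \<mu>, of y] stationary_on_pmf_eq[OF fin \<nu>, of y]
      by (simp add: left_diff_distrib sum_subtractf sum_distrib_left mult.assoc)
    show "d z = 0"
      using pos[OF z(1)] by (simp add: d_def q_def)
  qed
  then have eq: "pmf \<mu> x = q z * pmf \<nu> x" if "x \<in> \<Omega>" for x
    using that by (simp add: d_def)
  then have "(\<Sum>x\<in>\<Omega>. pmf \<mu> x) = q z * (\<Sum>x\<in>\<Omega>. pmf \<nu> x)"
    by (simp add: sum_distrib_left)
  then have "q z = 1" using sums by simp
  show ?thesis
  proof (rule pmf_eqI)
    fix x
    show "pmf \<mu> x = pmf \<nu> x"
    proof (cases "x \<in> \<Omega>")
      case True
      then show ?thesis using eq \<open>q z = 1\<close> by simp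
    next
      case False
      then have "pmf \<mu> x = 0" "pmf \<nu> x = 0"
        using sub by (auto simp: pmf_eq_0_set_pmf)
      then show ?thesis by simp
    qed
  qed
qed

text \<open>Balance turns the total flow into \<open>y\<close> into the total flow out of
  \<open>y\<close>, which is the mass of \<open>y\<close> times the total mass of
  \<open>K y\<close>.\<close>

lemma bind_pmf_detailed_balance:
  assumes "finite (set_pmf \<pi>)"
    and balance: "\<And>x y. pmf \<pi> x * pmf (K x) y = pmf \<pi> y * pmf (K y) x"
  shows "bind_pmf \<pi> K = \<pi>"
proof (rule pmf_eqI)
  fix y
  let ?S = "set_pmf \<pi>"
  have "pmf (bind_pmf \<pi> K) y = (\<Sum>x\<in>?S. pmf (K x) y * pmf \<pi> x)"
    unfolding pmf_bind using assms(1) by (intro integral_measure_pmf_real) auto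
  also have "\<dots> = (\<Sum>x\<in>?S. pmf \<pi> y * pmf (K y) x)"
    using balance by (intro sum.cong) (auto simp: mult.commute)
  also have "\<dots> = pmf \<pi> y"
  proof (cases "y \<in> ?S")
    case True
    \<comment> \<open>A positive flow from \<open>y\<close> to \<open>x\<close> is matched by one
      from \<open>x\<close> to \<open>y\<close>, so \<open>x\<close> carries mass. Hence the sum
      over \<open>?S\<close> captures all of \<open>K y\<close>.\<close>
    have "set_pmf (K y) \<subseteq> ?S"
    proof
      fix x assume "x \<in> set_pmf (K y)"
      then have "pmf \<pi> x * pmf (K x) y \<noteq> 0"
        using True unfolding balance[of x y] by (simp add: set_pmf_iff)
      then show "x \<in> ?S" by (simp add: set_pmf_iff)
    qed
    then show ?thesis
      using sum_pmf_eq_1[OF assms(1)] by (simp flip: sum_distrib_left)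
  next
    case False
    then show ?thesis by (simp add: set_pmf_iff)
  qed
  finally show "pmf (bind_pmf \<pi> K) y = pmf \<pi> y" .
qed

section \<open>Irreducibility of the logit dynamics on a finite game\<close>

lemma set_pmf_logit_choice:
  assumes "finite (strategies G i)" "strategies G i \<noteq> {}"
  shows "set_pmf (logit_choice \<beta> G i x) = strategies G i"
proof -
  have "(\<Sum>z\<in>strategies G i. exp (\<beta> * utility G i (x(i := z)))) > 0"
    using assms by (intro sum_pos) auto
  then show ?thesis
    by (auto simp: set_pmf_iff pmf_logit_choice[OF assms] logit_prob_def split: if_splits)
qed

text \<open>The equation \<open>z = x(i := z i)\<close> says that \<open>z\<close> agrees with
  \<open>x\<close> off \<open>i\<close>; then \<open>z i\<close> is the only preimage of
  \<open>z\<close>.\<close>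

lemma pmf_map_fun_upd:
  "pmf (map_pmf (\<lambda>y. x(i := y)) p) z = (if z = x(i := z i) then pmf p (z i) else 0)"
proof (cases "z = x(i := z i)")
  case True
  have "inj (\<lambda>y. x(i := y))"
    by (rule injI) (metis fun_upd_same)
  from pmf_map_inj'[OF this, of p "z i"] show ?thesis
    unfolding if_P[OF True] by (simp flip: True)
next
  case False
  then have "z \<notin> set_pmf (map_pmf (\<lambda>y. x(i := y)) p)" by auto
  then show ?thesis
    unfolding if_not_P[OF False] by (simp add: pmf_eq_0_set_pmf)
qed

locale finite_game =
  fixes G :: "('i, 's) game"
  assumes finite_players: "finite (players G)" and players_nonempty: "players G \<noteq> {}"
    and finite_strategies: "\<And>i. finite (strategies G i)"
    and strategies_nonempty: "\<And>i. strategies G i \<noteq> {}"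
begin

lemma finite_profiles: "finite (profiles G)"
  unfolding profiles_def using finite_players finite_strategies by (intro finite_PiE) auto

lemma profiles_nonempty: "profiles G \<noteq> {}"
  unfolding profiles_def using strategies_nonempty by (simp add: PiE_eq_empty_iff)

lemma fun_upd_profiles:
  assumes "x \<in> profiles G" "i \<in> players G" "s \<in> strategies G i"
  shows "x(i := s) \<in> profiles G"
  using assms by (auto simp: profiles_def PiE_iff extensional_def)

lemma fun_upd_in_logit_step:
  assumes "i \<in> players G" "s \<in> strategies G i"
  shows "x(i := s) \<in> set_pmf (logit_step \<beta> G x)"
  using assms finite_players players_nonempty
  by (auto simp: logit_step_def set_pmf_of_set set_pmf_logit_choice
      finite_strategies strategies_nonempty)

text \<open>The entries of \<open>x\<close> are replaced by those of \<open>z\<close> one player at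
  a time; each replacement has positive probability because the logit weights are
  exponentials.\<close>

lemma logit_step_irreducible:
  assumes x: "x \<in> profiles G" and z: "z \<in> profiles G"
  shows "(x, z) \<in> {(x, y). x \<in> profiles G \<and> y \<in> profiles G \<and> y \<in> set_pmf (logit_step \<beta> G x)}\<^sup>*"
    (is "_ \<in> ?E\<^sup>*")
proof -
  let ?w = "\<lambda>A i. if i \<in> A then z i else x i"
  have "?w A \<in> profiles G \<and> (x, ?w A) \<in> ?E\<^sup>*" if "finite A" "A \<subseteq> players G" for A
    using that
  proof (induction rule: finite_induct)
    case empty
    then show ?case using x by simp
  next
    case (insert i A)
    have i: "i \<in> players G" "z i \<in> strategies G i"
      using insert.prems z by (auto simp: profiles_def)
    have upd: "?w (insert i A) = (?w A)(i := z i)" by auto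
    have "(?w A)(i := z i) \<in> profiles G" "(?w A)(i := z i) \<in> set_pmf (logit_step \<beta> G (?w A))"
      using insert.IH insert.prems i by (simp_all add: fun_upd_profiles fun_upd_in_logit_step)
    moreover have IH: "?w A \<in> profiles G" "(x, ?w A) \<in> ?E\<^sup>*"
      using insert.IH insert.prems by auto
    ultimately have "(?w A, (?w A)(i := z i)) \<in> ?E" by blast
    with IH(2) have "(x, (?w A)(i := z i)) \<in> ?E\<^sup>*"
      by (rule rtrancl_into_rtrancl)
    with \<open>(?w A)(i := z i) \<in> profiles G\<close> show ?case
      unfolding upd ..
  qed
  from this[OF finite_players order_refl] have "(x, ?w (players G)) \<in> ?E\<^sup>*" ..
  \<comment> \<open>Off the players, both profiles are \<open>undefined\<close> by
    extensionality.\<close>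
  also have "?w (players G) = z"
    using x z by (auto simp: profiles_def PiE_iff extensional_def fun_eq_iff)
  finally show ?thesis .
qed

lemma logit_stationary_eqI:
  assumes "stationary_on (profiles G) (logit_step \<beta> G) \<pi>"
  shows "logit_stationary \<beta> G = \<pi>"
  unfolding logit_stationary_def
proof (rule the_equality)
  fix \<mu> assume "stationary_on (profiles G) (logit_step \<beta> G) \<mu>"
  from finite_profiles _ this assms show "\<mu> = \<pi>"
    by (rule stationary_on_unique) (rule logit_step_irreducible)
qed (fact assms)

end

section \<open>Reversibility of the Gibbs distribution under a common utility\<close>

locale common_utility_game = finite_game G for G :: "('i, 's) game" +
  fixes \<Phi> :: "('i \<Rightarrow> 's) \<Rightarrow> real"
  assumes utility_eq: "\<And>i x. utility G i x = \<Phi> x"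
begin

definition gibbs :: "real \<Rightarrow> ('i \<Rightarrow> 's) pmf" where
  "gibbs \<beta> = embed_pmf (\<lambda>x. if x \<in> profiles G
     then exp (\<beta> * \<Phi> x) / (\<Sum>y\<in>profiles G. exp (\<beta> * \<Phi> y)) else 0)"

lemma pmf_gibbs:
  "pmf (gibbs \<beta>) x = (if x \<in> profiles G
     then exp (\<beta> * \<Phi> x) / (\<Sum>y\<in>profiles G. exp (\<beta> * \<Phi> y)) else 0)"
  unfolding gibbs_def
proof (rule pmf_embed_pmf)
  let ?Z = "\<Sum>y\<in>profiles G. exp (\<beta> * \<Phi> y)"
  let ?f = "\<lambda>x. if x \<in> profiles G then exp (\<beta> * \<Phi> x) / ?Z else 0"
  have pos: "?Z > 0"
    using finite_profiles profiles_nonempty by (intro sum_pos) auto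
  then show "0 \<le> ?f x" for x by simp
  have "(\<integral>\<^sup>+x. ennreal (?f x) \<partial>count_space UNIV) = (\<Sum>x\<in>profiles G. ennreal (?f x))"
    using finite_profiles by (intro nn_integral_count_space') (auto split: if_splits)
  also have "\<dots> = ennreal (\<Sum>x\<in>profiles G. exp (\<beta> * \<Phi> x) / ?Z)"
    using pos by (simp add: sum_ennreal)
  also have "(\<Sum>x\<in>profiles G. exp (\<beta> * \<Phi> x) / ?Z) = 1"
    using pos by (simp flip: sum_divide_distrib)
  finally show "(\<integral>\<^sup>+x. ennreal (?f x) \<partial>count_space UNIV) = 1" by simp
qed

lemma set_pmf_gibbs_subset: "set_pmf (gibbs \<beta>) \<subseteq> profiles G"
  by (rule subsetI, rule ccontr) (simp add: set_pmf_iff pmf_gibbs)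

text \<open>If \<open>x\<close> and \<open>z\<close> differ at most at \<open>i\<close>, their
  updates at \<open>i\<close> share one normalising sum, and both sides equal the product of the
  weights of \<open>x\<close> and \<open>z\<close> over the same denominator. Otherwise neither is
  reachable from the other by such an update.\<close>

lemma gibbs_logit_update_balance:
  fixes \<beta> :: real
  assumes i: "i \<in> players G"
  defines "K \<equiv> \<lambda>x. map_pmf (\<lambda>y. x(i := y)) (logit_choice \<beta> G i x)"
  shows "pmf (gibbs \<beta>) x * pmf (K x) z = pmf (gibbs \<beta>) z * pmf (K z) x"
proof (cases "z = x(i := z i)")
  case False
  moreover from False have "x \<noteq> z(i := x i)" by (metis fun_upd_triv fun_upd_upd)
  ultimately show ?thesis by (simp add: K_def pmf_map_fun_upd)
next
  case True
  then have zx: "x = z(i := x i)" by (metis fun_upd_triv fun_upd_upd)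
  have upd: "z(i := s) = x(i := s)" for s
    using True by (metis fun_upd_upd)
  have xz: "pmf (K x) z = (if z i \<in> strategies G i then
      exp (\<beta> * \<Phi> z) / (\<Sum>s\<in>strategies G i. exp (\<beta> * \<Phi> (x(i := s)))) else 0)"
    unfolding K_def pmf_map_fun_upd if_P[OF True]
    by (simp add: pmf_logit_choice finite_strategies strategies_nonempty logit_prob_def
        utility_eq flip: True)
  have zx': "pmf (K z) x = (if x i \<in> strategies G i then
      exp (\<beta> * \<Phi> x) / (\<Sum>s\<in>strategies G i. exp (\<beta> * \<Phi> (x(i := s)))) else 0)"
    unfolding K_def pmf_map_fun_upd if_P[OF zx]
    by (simp add: pmf_logit_choice finite_strategies strategies_nonempty logit_prob_def
        utility_eq upd flip: zx)
  \<comment> \<open>This matches the nonzero branches of the two sides.\<close>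
  have "x \<in> profiles G \<and> z i \<in> strategies G i \<longleftrightarrow> z \<in> profiles G \<and> x i \<in> strategies G i"
    using fun_upd_profiles[of x i "z i", folded True] fun_upd_profiles[of z i "x i", folded zx] i
    by (auto simp: profiles_def)
  then show ?thesis unfolding xz zx' pmf_gibbs by auto
qed

text \<open>A step is a mixture over the players of single-player updates. Sampling the player
  before the profile reduces invariance to that of each update, which follows from detailed
  balance.\<close>

lemma stationary_on_gibbs: "stationary_on (profiles G) (logit_step \<beta> G) (gibbs \<beta>)"
proof -
  let ?K = "\<lambda>i x. map_pmf (\<lambda>y. x(i := y)) (logit_choice \<beta> G i x)"
  have "finite (set_pmf (gibbs \<beta>))"
    using finite_subset[OF set_pmf_gibbs_subset finite_profiles] .
  then have inv: "bind_pmf (gibbs \<beta>) (?K i) = gibbs \<beta>" if "i \<in> players G" for i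
    using gibbs_logit_update_balance[OF that] by (intro bind_pmf_detailed_balance) auto
  have "bind_pmf (gibbs \<beta>) (logit_step \<beta> G) =
      bind_pmf (pmf_of_set (players G)) (\<lambda>i. bind_pmf (gibbs \<beta>) (?K i))"
    unfolding logit_step_def by (rule bind_commute_pmf)
  also have "\<dots> = bind_pmf (pmf_of_set (players G)) (\<lambda>_. gibbs \<beta>)"
    using finite_players players_nonempty inv by (intro bind_pmf_cong) auto
  finally show ?thesis
    using set_pmf_gibbs_subset by (simp add: stationary_on_def)
qed

lemma stationary_on_logit_stationary:
  "stationary_on (profiles G) (logit_step \<beta> G) (logit_stationary \<beta> G)"
  by (subst logit_stationary_eqI[OF stationary_on_gibbs]) (rule stationary_on_gibbs)

end

section \<open>Parity in the XOR game and the expected welfare\<close>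

lemma pmf_bool_eqI:
  fixes p q :: "bool pmf"
  assumes "pmf p True = pmf q True"
  shows "p = q"
proof (rule pmf_eqI)
  fix b
  show "pmf p b = pmf q b"
    using assms pmf_False_conv_True[of p] pmf_False_conv_True[of q] by (cases b) auto
qed

definition odd_profile :: "nat \<Rightarrow> (nat \<Rightarrow> nat) \<Rightarrow> bool" where
  "odd_profile n x \<longleftrightarrow> odd (card {j \<in> {..<n}. x j = 1})"

lemma odd_profile_fun_upd:
  assumes "i < n"
  shows "odd_profile n (x(i := 1)) \<longleftrightarrow> \<not> odd_profile n (x(i := 0))"
proof -
  have "{j \<in> {..<n}. (x(i := 1)) j = 1} = insert i {j \<in> {..<n}. (x(i := 0)) j = 1}"
    using assms by auto
  then show ?thesis by (simp add: odd_profile_def)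
qed

lemma common_utility_xor_game:
  assumes "n \<ge> 1"
  shows "common_utility_game (xor_game n) (\<lambda>x. if odd_profile n x then - 1 else 0)"
  using assms by unfold_locales (auto simp: xor_game_def odd_profile_def lessThan_empty_iff)

text \<open>Exactly one of the two entries gives an odd profile. Its weight is
  \<open>exp (- \<beta>)\<close> and that of the other is 1, whatever \<open>x\<close> and
  \<open>i\<close> are.\<close>

lemma odd_profile_logit_update:
  assumes "i < n"
  shows "map_pmf (\<lambda>y. odd_profile n (x(i := y))) (logit_choice \<beta> (xor_game n) i x) =
    bernoulli_pmf (1 / (1 + exp \<beta>))"
proof (rule pmf_bool_eqI)
  let ?p = "logit_choice \<beta> (xor_game n) i x"
  let ?O = "\<lambda>y. odd_profile n (x(i := y))"
  have strat: "strategies (xor_game n) i = {0, 1}" by (simp add: xor_game_def)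
  have util: "utility (xor_game n) i y = (if odd_profile n y then - 1 else 0)" for y
    by (simp add: xor_game_def odd_profile_def)
  have sub: "set_pmf ?p \<subseteq> {0, 1}" by (subst set_pmf_logit_choice) (auto simp: strat)
  have "pmf (map_pmf ?O ?p) True = measure_pmf.expectation ?p (indicator {y. ?O y})"
    by (simp add: pmf_map vimage_def)
  also have "\<dots> = (\<Sum>y\<in>{0, 1}. indicator {y. ?O y} y * pmf ?p y)"
    using sub by (intro integral_measure_pmf_real) auto
  \<comment> \<open>The case split decides which of the entries 0 and 1 is the odd choice; the value
    is the same in both cases.\<close>
  also have "\<dots> = exp (- \<beta>) / (1 + exp (- \<beta>))"
    using odd_profile_fun_upd[OF assms, of x]
    by (cases "?O 0") (simp_all add: pmf_logit_choice strat logit_prob_def util add.commute)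
  also have "\<dots> = 1 / (1 + exp \<beta>)"
    by (simp add: exp_minus field_simps)
  also have "\<dots> = pmf (bernoulli_pmf (1 / (1 + exp \<beta>))) True"
    by (simp add: add_pos_pos less_imp_le)
  finally show "pmf (map_pmf ?O ?p) True = pmf (bernoulli_pmf (1 / (1 + exp \<beta>))) True" .
qed

lemma odd_profile_logit_step:
  assumes "n \<ge> 1"
  shows "map_pmf (odd_profile n) (logit_step \<beta> (xor_game n) x) = bernoulli_pmf (1 / (1 + exp \<beta>))"
proof -
  let ?B = "bernoulli_pmf (1 / (1 + exp \<beta>))"
  have players: "players (xor_game n) = {..<n}" by (simp add: xor_game_def)
  have "map_pmf (odd_profile n) (logit_step \<beta> (xor_game n) x) =
      bind_pmf (pmf_of_set {..<n})
        (\<lambda>i. map_pmf (\<lambda>y. odd_profile n (x(i := y))) (logit_choice \<beta> (xor_game n) i x))"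
    by (simp add: logit_step_def map_bind_pmf pmf.map_comp o_def players)
  also have "\<dots> = bind_pmf (pmf_of_set {..<n}) (\<lambda>_. ?B)"
    using assms odd_profile_logit_update
    by (intro bind_pmf_cong) (auto simp: lessThan_empty_iff)
  finally show ?thesis by simp
qed

text \<open>One step erases all memory of the starting parity, and a stationary distribution is its
  own distribution after one step.\<close>

lemma odd_profile_stationary:
  assumes "n \<ge> 1" and "stationary_on \<Omega> (logit_step \<beta> (xor_game n)) \<pi>"
  shows "map_pmf (odd_profile n) \<pi> = bernoulli_pmf (1 / (1 + exp \<beta>))"
proof -
  have "map_pmf (odd_profile n) \<pi> = map_pmf (odd_profile n) (bind_pmf \<pi> (logit_step \<beta> (xor_game n)))"
    using assms(2) by (simp add: stationary_on_def)
  also have "\<dots> = bernoulli_pmf (1 / (1 + exp \<beta>))"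
    by (simp add: map_bind_pmf odd_profile_logit_step[OF assms(1)])
  finally show ?thesis .
qed

lemma social_welfare_xor_game:
  "social_welfare (xor_game n) x = - real n * of_bool (odd_profile n x)"
  by (simp add: social_welfare_def xor_game_def odd_profile_def)

theorem theorem22:
  fixes n :: nat and \<beta> :: real
  assumes "n \<ge> 1" and "\<beta> \<ge> 0"
  shows "measure_pmf.expectation (logit_stationary \<beta> (xor_game n)) (social_welfare (xor_game n))
           = - (real n / (1 + exp \<beta>))"
proof -
  let ?\<pi> = "logit_stationary \<beta> (xor_game n)"
  let ?B = "bernoulli_pmf (1 / (1 + exp \<beta>))"
  let ?f = "\<lambda>b. - real n * of_bool b"
  have "map_pmf (odd_profile n) ?\<pi> = ?B"
    by (rule odd_profile_stationary[OF assms(1)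
          common_utility_game.stationary_on_logit_stationary[OF common_utility_xor_game[OF assms(1)]]])
  \<comment> \<open>The welfare depends on the parity alone, so its expectation is one over a
    two-point distribution.\<close>
  moreover have "measure_pmf.expectation ?\<pi> (social_welfare (xor_game n)) =
      measure_pmf.expectation (map_pmf (odd_profile n) ?\<pi>) ?f"
    by (simp add: social_welfare_xor_game[abs_def])
  ultimately have "measure_pmf.expectation ?\<pi> (social_welfare (xor_game n)) =
      measure_pmf.expectation ?B ?f"
    by simp
  also have "\<dots> = - (real n / (1 + exp \<beta>))"
    by (subst integral_bernoulli_pmf) (simp_all add: add_pos_pos less_imp_le)
  finally show ?thesis .
qed

end
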